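(* Let $L$ be a lattice operad and $\phi:\mathcal P\to\mathcal Q$ a morphism of $\mathbb K$-linear operads. Define $\phi_*:Filt(L,\mathcal P)\to Filt(L,\mathcal Q)$ by setting $$(\phi_*(F\mathcal P))_p\mathcal Q(n):=\phi(F_p\mathcal P(n))$$ for any $L$-filtration $F\mathcal P$, all $n\ge1$ and $p\in L(n)$. Then: (1) $\phi_*(F\mathcal P)$ is a well-defined $L$-filtration of $\mathcal Q$; (2) $(\psi\phi)_*=\psi_*\phi_*$ for any pair of $\mathbb K$-linear operad morphisms $\mathcal P\xrightarrow{\phi}\mathcal Q\xrightarrow{\psi}\mathcal R$.
   Context: A lattice operad is an operad $L=\{L(n)\}_{n\ge1}$ (possibly non-symmetric) in the category of lattices and lattice homomorphisms with the cartesian product: each $L(n)$ is a lattice, each partial composition $\circ_i:L(m)\times L(n)\to L(m+n-1)$, $1\le i\le m$, is a lattice homomorphism, and in the symmetric case the symmetric groups act by lattice homomorphisms. Morphisms of $\mathbb K$-linear operads are arity-wise linear maps commuting with partial compositions, with symmetric group actions (in the symmetric case), and with operadic units when these are part of the structure. An $L$-filtration $F\mathcal P=\{F_p\mathcal P(n)\}_{p\in L(n),n\ge1}$ of a $\mathbb K$-linear operad $\mathcal P$ is a collection of $\mathbb K$-subspaces $F_p\mathcal P(n)\subset\mathcal P(n)$ such that: (i) $F_{p'}\mathcal P(n)\subset F_{p''}\mathcal P(n)$ whenever $p'\le p''$ in $L(n)$; (ii) $F_p\mathcal P(n)\cdot\sigma=F_{p\cdot\sigma}\mathcal P(n)$ for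 $p\in L(n)$, $\sigma\in\mathbb S_n$ (in the symmetric case); (iii) $F_a\mathcal P(m)\circ_iF_b\mathcal P(n)\subset F_{a\circ_ib}\mathcal P(m+n-1)$ for all $a\in L(m)$, $b\in L(n)$, $1\le i\le m$; (iv) if $L(1)$ has a smallest element $\mathbf 0$ and $e\in\mathcal P(1)$ is the operadic unit, if it exists, then $\mathbb K\cdot e\subset F_{\mathbf 0}\mathcal P(1)$. $Filt(L,\mathcal P)$ is the set of all $L$-filtrations of $\mathcal P$. *)

theory Defs
  imports "HOL-Algebra.Lattice" "HOL-Algebra.Module" "HOL-Combinatorics.Permutations"
begin

section \<open>Operads, symmetric or not, with or without unit\<close>

text \<open>
  An operad \<open>P = {P(n)}\<close>, \<open>n \<ge> 1\<close>, is given by its components \<open>arity P n\<close>, its partial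
  compositions \<open>pcomp P m n i : P(m) \<times> P(n) \<rightarrow> P(m+n-1)\<close>, \<open>1 \<le> i \<le> m\<close>, and the right actions
  \<open>act P n \<sigma>\<close> of the permutations \<open>\<sigma>\<close> of \<open>{1..n}\<close>. The parameter \<open>symm\<close> used below tells whether we
  are in the symmetric case; in the non-symmetric case the field \<open>act\<close> carries no meaning. The value
  \<open>None\<close> of \<open>op_unit\<close> means that an operadic unit is not part of the structure. Components of arity
  0 and compositions with \<open>i\<close> out of range are irrelevant.
\<close>

record ('b, 'a) operad_struct =
  arity :: "nat \<Rightarrow> 'b"
  pcomp :: "nat \<Rightarrow> nat \<Rightarrow> nat \<Rightarrow> 'a \<Rightarrow> 'a \<Rightarrow> 'a"
  act :: "nat \<Rightarrow> (nat \<Rightarrow> nat) \<Rightarrow> 'a \<Rightarrow> 'a"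
  op_unit :: "'a option"

text \<open>
  The partial composition \<open>\<sigma> \<circ>\<^sub>i \<tau>\<close> of permutations \<open>\<sigma>\<close> of \<open>{1..m}\<close> and \<open>\<tau>\<close> of \<open>{1..n}\<close>: the
  permutation of \<open>{1..m+n-1}\<close> that permutes the inputs as \<open>\<sigma>\<close> does, with the input \<open>i\<close> replaced by
  the block \<open>{i..i+n-1}\<close>, which is permuted internally by \<open>\<tau>\<close>. The convention is that \<open>\<mu> \<cdot> \<sigma>\<close> feeds its
  input number \<open>j\<close> into the input number \<open>\<sigma> j\<close> of \<open>\<mu>\<close>, that is
  \<open>(\<mu> \<cdot> \<sigma>)(x\<^sub>1, \<dots>, x\<^sub>m) = \<mu>(y\<^sub>1, \<dots>, y\<^sub>m)\<close> with \<open>y\<^sub>k = x\<^sub>j\<close> for \<open>k = \<sigma> j\<close>.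
\<close>

definition perm_pcomp :: "nat \<Rightarrow> nat \<Rightarrow> (nat \<Rightarrow> nat) \<Rightarrow> (nat \<Rightarrow> nat) \<Rightarrow> nat \<Rightarrow> nat" where
  "perm_pcomp n i \<sigma> \<tau> k =
     (if i \<le> k \<and> k < i + n then \<sigma> i + \<tau> (k - i + 1) - 1
      else let j = (if k < i then k else k - n + 1)
           in if \<sigma> j < \<sigma> i then \<sigma> j else \<sigma> j + n - 1)"

text \<open>The operad axioms, on the level of underlying sets.\<close>

locale operad =
  fixes symm :: bool
    and P :: "(('a, 'x) partial_object_scheme, 'a) operad_struct"
  assumes pcomp_closed:
      "\<lbrakk>1 \<le> i; i \<le> m; 1 \<le> n; x \<in> carrier (arity P m); y \<in> carrier (arity P n)\<rbrakk>
       \<Longrightarrow> pcomp P m n i x y \<in> carrier (arity P (m + n - 1))"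
    and pcomp_sequential:
      "\<lbrakk>1 \<le> i; i \<le> l; 1 \<le> j; j \<le> m; 1 \<le> n;
        x \<in> carrier (arity P l); y \<in> carrier (arity P m); z \<in> carrier (arity P n)\<rbrakk>
       \<Longrightarrow> pcomp P (l + m - 1) n (i + j - 1) (pcomp P l m i x y) z
         = pcomp P l (m + n - 1) i x (pcomp P m n j y z)"
    and pcomp_parallel:
      "\<lbrakk>1 \<le> i; i < k; k \<le> l; 1 \<le> m; 1 \<le> n;
        x \<in> carrier (arity P l); y \<in> carrier (arity P m); z \<in> carrier (arity P n)\<rbrakk>
       \<Longrightarrow> pcomp P (l + m - 1) n (k + m - 1) (pcomp P l m i x y) z
         = pcomp P (l + n - 1) m i (pcomp P l n k x z) y"
    and unit_closed:
      "op_unit P = Some e \<Longrightarrow> e \<in> carrier (arity P 1)"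
    and unit_left:
      "\<lbrakk>op_unit P = Some e; 1 \<le> n; x \<in> carrier (arity P n)\<rbrakk> \<Longrightarrow> pcomp P 1 n 1 e x = x"
    and unit_right:
      "\<lbrakk>op_unit P = Some e; 1 \<le> i; i \<le> n; x \<in> carrier (arity P n)\<rbrakk> \<Longrightarrow> pcomp P n 1 i x e = x"
    and act_closed:
      "\<lbrakk>symm; 1 \<le> n; \<sigma> permutes {1..n}; x \<in> carrier (arity P n)\<rbrakk>
       \<Longrightarrow> act P n \<sigma> x \<in> carrier (arity P n)"
    and act_id:
      "\<lbrakk>symm; 1 \<le> n; x \<in> carrier (arity P n)\<rbrakk> \<Longrightarrow> act P n id x = x"
    and act_comp:
      "\<lbrakk>symm; 1 \<le> n; \<sigma> permutes {1..n}; \<tau> permutes {1..n}; x \<in> carrier (arity P n)\<rbrakk>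
       \<Longrightarrow> act P n \<tau> (act P n \<sigma> x) = act P n (\<sigma> \<circ> \<tau>) x"
    and pcomp_equivariant:
      "\<lbrakk>symm; 1 \<le> i; i \<le> m; 1 \<le> n; \<sigma> permutes {1..m}; \<tau> permutes {1..n};
        x \<in> carrier (arity P m); y \<in> carrier (arity P n)\<rbrakk>
       \<Longrightarrow> pcomp P m n i (act P m \<sigma> x) (act P n \<tau> y)
         = act P (m + n - 1) (perm_pcomp n i \<sigma> \<tau>) (pcomp P m n (\<sigma> i) x y)"


section \<open>Lattice operads\<close>

definition prod_gorder :: "'a gorder \<Rightarrow> 'b gorder \<Rightarrow> ('a \<times> 'b) gorder" where
  "prod_gorder A B =
     \<lparr>carrier = carrier A \<times> carrier B, eq = (=),
      le = (\<lambda>(x, y) (x', y'). x \<sqsubseteq>\<^bsub>A\<^esub> x' \<and> y \<sqsubseteq>\<^bsub>B\<^esub> y')\<rparr>"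

definition lattice_hom :: "'a gorder \<Rightarrow> 'b gorder \<Rightarrow> ('a \<Rightarrow> 'b) set" where
  "lattice_hom A B = {f \<in> carrier A \<rightarrow> carrier B. join_pres A B f \<and> meet_pres A B f}"

locale lattice_operad = operad symm L
  for symm :: bool and L :: "('l gorder, 'l) operad_struct" +
  assumes arity_lattice: "1 \<le> n \<Longrightarrow> lattice (arity L n)"
    and pcomp_lattice_hom:
      "\<lbrakk>1 \<le> i; i \<le> m; 1 \<le> n\<rbrakk>
       \<Longrightarrow> (\<lambda>(a, b). pcomp L m n i a b)
           \<in> lattice_hom (prod_gorder (arity L m) (arity L n)) (arity L (m + n - 1))"
    and act_lattice_hom:
      "\<lbrakk>symm; 1 \<le> n; \<sigma> permutes {1..n}\<rbrakk>
       \<Longrightarrow> act L n \<sigma> \<in> lattice_hom (arity L n) (arity L n)"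


section \<open>Linear operads and their morphisms\<close>

definition linear_maps ::
    "('k, 'r) ring_scheme \<Rightarrow> ('k, 'a) module \<Rightarrow> ('k, 'b) module \<Rightarrow> ('a \<Rightarrow> 'b) set" where
  "linear_maps K V W =
     {f \<in> carrier V \<rightarrow> carrier W.
        (\<forall>x \<in> carrier V. \<forall>y \<in> carrier V. f (x \<oplus>\<^bsub>V\<^esub> y) = f x \<oplus>\<^bsub>W\<^esub> f y) \<and>
        (\<forall>c \<in> carrier K. \<forall>x \<in> carrier V. f (c \<odot>\<^bsub>V\<^esub> x) = c \<odot>\<^bsub>W\<^esub> f x)}"

locale linear_operad = field K + operad symm P
  for symm :: bool and K :: "('k, 'r) ring_scheme" (structure)
    and P :: "(('k, 'p) module, 'p) operad_struct" +
  assumes arity_module: "1 \<le> n \<Longrightarrow> module K (arity P n)"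
    and pcomp_linear_left:
      "\<lbrakk>1 \<le> i; i \<le> m; 1 \<le> n; y \<in> carrier (arity P n)\<rbrakk>
       \<Longrightarrow> (\<lambda>x. pcomp P m n i x y) \<in> linear_maps K (arity P m) (arity P (m + n - 1))"
    and pcomp_linear_right:
      "\<lbrakk>1 \<le> i; i \<le> m; 1 \<le> n; x \<in> carrier (arity P m)\<rbrakk>
       \<Longrightarrow> (\<lambda>y. pcomp P m n i x y) \<in> linear_maps K (arity P n) (arity P (m + n - 1))"
    and act_linear:
      "\<lbrakk>symm; 1 \<le> n; \<sigma> permutes {1..n}\<rbrakk> \<Longrightarrow> act P n \<sigma> \<in> linear_maps K (arity P n) (arity P n)"

text \<open>
  A morphism \<open>\<phi>\<close> is the family of its components \<open>\<phi> n\<close>. The clause on units makes source and target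
  either both unital, with \<open>\<phi> 1\<close> preserving the unit, or both without unit as part of the structure.
\<close>

locale linear_operad_morphism =
  source: linear_operad symm K P + target: linear_operad symm K Q
  for symm :: bool and K :: "('k, 'r) ring_scheme" (structure)
    and P :: "(('k, 'p) module, 'p) operad_struct"
    and Q :: "(('k, 'q) module, 'q) operad_struct"
    and \<phi> :: "nat \<Rightarrow> 'p \<Rightarrow> 'q" +
  assumes linear: "1 \<le> n \<Longrightarrow> \<phi> n \<in> linear_maps K (arity P n) (arity Q n)"
    and commutes_pcomp:
      "\<lbrakk>1 \<le> i; i \<le> m; 1 \<le> n; x \<in> carrier (arity P m); y \<in> carrier (arity P n)\<rbrakk>
       \<Longrightarrow> \<phi> (m + n - 1) (pcomp P m n i x y) = pcomp Q m n i (\<phi> m x) (\<phi> n y)"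
    and commutes_act:
      "\<lbrakk>symm; 1 \<le> n; \<sigma> permutes {1..n}; x \<in> carrier (arity P n)\<rbrakk>
       \<Longrightarrow> \<phi> n (act P n \<sigma> x) = act Q n \<sigma> (\<phi> n x)"
    and commutes_unit: "op_unit Q = map_option (\<phi> 1) (op_unit P)"

definition morphism_comp :: "(nat \<Rightarrow> 'q \<Rightarrow> 's) \<Rightarrow> (nat \<Rightarrow> 'p \<Rightarrow> 'q) \<Rightarrow> nat \<Rightarrow> 'p \<Rightarrow> 's" where
  "morphism_comp \<psi> \<phi> n = \<psi> n \<circ> \<phi> n"

lemma linear_operad_morphism_comp:
  assumes "linear_operad_morphism symm K P Q \<phi>" "linear_operad_morphism symm K Q R \<psi>"
  shows "linear_operad_morphism symm K P R (morphism_comp \<psi> \<phi>)"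
proof -
  interpret f: linear_operad_morphism symm K P Q \<phi> by fact
  interpret g: linear_operad_morphism symm K Q R \<psi> by fact
  have closed: "\<phi> n x \<in> carrier (arity Q n)" if "1 \<le> n" "x \<in> carrier (arity P n)" for n x
    using f.linear[OF that(1)] that(2) by (auto simp: linear_maps_def)
  show ?thesis
  proof (unfold_locales, goal_cases)
    case (1 n)
    have "\<phi> n \<in> linear_maps K (arity P n) (arity Q n)"
      and "\<psi> n \<in> linear_maps K (arity Q n) (arity R n)"
      using f.linear[OF 1] g.linear[OF 1] .
    then show ?case
      by (auto simp: linear_maps_def morphism_comp_def Pi_iff)
  next
    case (2 i m n x y)
    then show ?case
      using f.commutes_pcomp[OF 2] g.commutes_pcomp[of i m n "\<phi> m x" "\<phi> n y"]
        closed[of m x] closed[of n y] by (simp add: morphism_comp_def)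
  next
    case (3 n \<sigma> x)
    then show ?case
      using f.commutes_act[OF 3] g.commutes_act[of n \<sigma> "\<phi> n x"] closed[of n x]
      by (simp add: morphism_comp_def)
  next
    case 4
    show ?case
      using f.commutes_unit g.commutes_unit
      by (simp add: morphism_comp_def option.map_comp)
  qed
qed


section \<open>Filtrations\<close>

text \<open>
  A filtration is a family indexed by \<open>n \<ge> 1\<close> and \<open>p \<in> L(n)\<close>. Such families are represented by
  functions that are \<open>undefined\<close> outside of the index set, so that equality of elements of
  \<open>Filt symm K L P\<close> is equality of families.
\<close>

definition Filt ::
    "bool \<Rightarrow> ('k, 'r) ring_scheme \<Rightarrow> ('l gorder, 'l) operad_struct
     \<Rightarrow> (('k, 'p) module, 'p) operad_struct \<Rightarrow> (nat \<Rightarrow> 'l \<Rightarrow> 'p set) set" where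
  "Filt symm K L P =
     {F \<in> (\<Pi>\<^sub>E n \<in> {1..}. \<Pi>\<^sub>E p \<in> carrier (arity L n). {V. submodule V K (arity P n)}).
        (\<forall>n \<ge> 1. \<forall>p \<in> carrier (arity L n). \<forall>q \<in> carrier (arity L n).
           p \<sqsubseteq>\<^bsub>arity L n\<^esub> q \<longrightarrow> F n p \<subseteq> F n q) \<and>
        (symm \<longrightarrow>
          (\<forall>n \<ge> 1. \<forall>p \<in> carrier (arity L n). \<forall>\<sigma>. \<sigma> permutes {1..n} \<longrightarrow>
             act P n \<sigma> ` F n p = F n (act L n \<sigma> p))) \<and>
        (\<forall>m \<ge> 1. \<forall>n \<ge> 1. \<forall>i \<in> {1..m}.
           \<forall>a \<in> carrier (arity L m). \<forall>b \<in> carrier (arity L n). \<forall>x \<in> F m a. \<forall>y \<in> F n b.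
             pcomp P m n i x y \<in> F (m + n - 1) (pcomp L m n i a b)) \<and>
        (\<forall>z e. least (arity L 1) z (carrier (arity L 1)) \<longrightarrow> op_unit P = Some e \<longrightarrow>
           {c \<odot>\<^bsub>arity P 1\<^esub> e |c. c \<in> carrier K} \<subseteq> F 1 z)}"

text \<open>The map \<open>\<phi>\<^sub>*\<close>, with domain \<open>Filt symm K L P\<close>.\<close>

definition push_filt ::
    "bool \<Rightarrow> ('k, 'r) ring_scheme \<Rightarrow> ('l gorder, 'l) operad_struct
     \<Rightarrow> (('k, 'p) module, 'p) operad_struct \<Rightarrow> (nat \<Rightarrow> 'p \<Rightarrow> 'q)
     \<Rightarrow> (nat \<Rightarrow> 'l \<Rightarrow> 'p set) \<Rightarrow> nat \<Rightarrow> 'l \<Rightarrow> 'q set" where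
  "push_filt symm K L P \<phi> =
     (\<lambda>F \<in> Filt symm K L P. \<lambda>n \<in> {1..}. \<lambda>p \<in> carrier (arity L n). \<phi> n ` F n p)"

end

theory Submission
  imports Defs
begin

text \<open>Each filtration condition on \<open>F\<close> is expressed by operations that \<phi>
  respects, so it survives taking images. Linearity turns subspaces into subspaces
  (\<open>submodule_image\<close>) and images are monotone. For the action, \<phi>(U) acted on by
  \<sigma> equals \<phi>(U acted on by \<sigma>). For compositions, one lifts the two arguments to
  preimages and composes in \<open>P\<close>. For units, a unit of \<open>Q\<close> is the image of
  a unit of \<open>P\<close>, so the line it spans is the image of a line. This gives
  \<open>push_filt_in_Filt\<close>. Functoriality is the set identity (\<psi>\<phi>)(U) =
  \<psi>(\<phi>(U)); well-definedness enters there because \<phi> must send filtrations into the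
  domain of the second pushforward.\<close>

lemma submodule_image:
  assumes "module K V" "module K W" and f: "f \<in> linear_maps K V W"
    and "submodule U K V"
  shows "submodule (f ` U) K W"
proof -
  interpret V: module K V by fact
  interpret W: module K W by fact
  have U: "U \<subseteq> carrier V" "\<And>c x. c \<in> carrier K \<Longrightarrow> x \<in> U \<Longrightarrow> c \<odot>\<^bsub>V\<^esub> x \<in> U"
    "\<And>x y. x \<in> U \<Longrightarrow> y \<in> U \<Longrightarrow> x \<oplus>\<^bsub>V\<^esub> y \<in> U" "\<zero>\<^bsub>V\<^esub> \<in> U"
    \<comment> \<open>\<open>submodule\<close> extends \<open>subgroup\<close> of the additive
      monoid, whose neutral element is the zero of \<open>V\<close>; this supplies the last
      fact.\<close>
    using V.submoduleE[OF assms(4)] V.module_axioms submodule.axioms(1)[OF assms(4)]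
    by (auto simp: subgroup_def)
  have add: "f (x \<oplus>\<^bsub>V\<^esub> y) = f x \<oplus>\<^bsub>W\<^esub> f y" if "x \<in> carrier V" "y \<in> carrier V" for x y
    using f that by (auto simp: linear_maps_def)
  have smult: "f (c \<odot>\<^bsub>V\<^esub> x) = c \<odot>\<^bsub>W\<^esub> f x" if "c \<in> carrier K" "x \<in> carrier V" for c x
    using f that by (auto simp: linear_maps_def)
  have closed: "f x \<in> carrier W" if "x \<in> carrier V" for x
    using f that by (auto simp: linear_maps_def)
  show ?thesis
  proof (rule W.submoduleI)
    show "f ` U \<subseteq> carrier W"
      using U(1) closed by blast
    \<comment> \<open>\<open>linear_maps\<close> only speaks of sums and scalar multiples.
      Preservation of zero comes from writing the zero vector as the scalar 0 times itself.\<close>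
    have "f \<zero>\<^bsub>V\<^esub> = \<zero>\<^bsub>K\<^esub> \<odot>\<^bsub>W\<^esub> f \<zero>\<^bsub>V\<^esub>"
      using smult[of "\<zero>\<^bsub>K\<^esub>" "\<zero>\<^bsub>V\<^esub>"] by simp
    then have "f \<zero>\<^bsub>V\<^esub> = \<zero>\<^bsub>W\<^esub>"
      using closed[of "\<zero>\<^bsub>V\<^esub>"] by simp
    then show "\<zero>\<^bsub>W\<^esub> \<in> f ` U"
      using U(4) by (metis imageI)
    show "\<ominus>\<^bsub>W\<^esub> y \<in> f ` U" if y: "y \<in> f ` U" for y
    proof -
      obtain x where x: "x \<in> U" "y = f x" using y by blast
      \<comment> \<open>Likewise, negation is handled as multiplication by the scalar -1.\<close>
      have "\<ominus>\<^bsub>W\<^esub> y = (\<ominus>\<^bsub>K\<^esub> \<one>\<^bsub>K\<^esub>) \<odot>\<^bsub>W\<^esub> f x"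
        using x U(1) closed[of x] by (auto simp: W.smult_l_minus)
      also have "\<dots> = f ((\<ominus>\<^bsub>K\<^esub> \<one>\<^bsub>K\<^esub>) \<odot>\<^bsub>V\<^esub> x)"
        using x U(1) smult by auto
      finally show ?thesis using x U(2) by auto
    qed
    show "y \<oplus>\<^bsub>W\<^esub> y' \<in> f ` U" if y: "y \<in> f ` U" "y' \<in> f ` U" for y y'
    proof -
      obtain x x' where x: "x \<in> U" "y = f x" "x' \<in> U" "y' = f x'" using y by blast
      then have "y \<oplus>\<^bsub>W\<^esub> y' = f (x \<oplus>\<^bsub>V\<^esub> x')" by (simp add: add subsetD[OF U(1)])
      then show ?thesis using x U(3) by blast
    qed
    show "c \<odot>\<^bsub>W\<^esub> y \<in> f ` U" if c: "c \<in> carrier K" and y: "y \<in> f ` U" for c y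
    proof -
      obtain x where x: "x \<in> U" "y = f x" using y by blast
      then have "c \<odot>\<^bsub>W\<^esub> y = f (c \<odot>\<^bsub>V\<^esub> x)" using U(1) smult c by auto
      then show ?thesis using x U(2) c by blast
    qed
  qed
qed

lemma push_filt_apply:
  assumes "F \<in> Filt symm K L P" "1 \<le> n" "p \<in> carrier (arity L n)"
  shows "push_filt symm K L P \<phi> F n p = \<phi> n ` F n p"
  using assms by (simp add: push_filt_def)

lemma
  assumes "F \<in> Filt symm K L P"
  shows FiltD_PiE:
      "F \<in> (\<Pi>\<^sub>E n \<in> {1..}. \<Pi>\<^sub>E p \<in> carrier (arity L n). {V. submodule V K (arity P n)})"
    and FiltD_mono: "\<lbrakk>1 \<le> n; p \<in> carrier (arity L n); q \<in> carrier (arity L n); p \<sqsubseteq>\<^bsub>arity L n\<^esub> q\<rbrakk>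
      \<Longrightarrow> F n p \<subseteq> F n q"
    and FiltD_act: "\<lbrakk>symm; 1 \<le> n; p \<in> carrier (arity L n); \<sigma> permutes {1..n}\<rbrakk>
      \<Longrightarrow> act P n \<sigma> ` F n p = F n (act L n \<sigma> p)"
    and FiltD_pcomp: "\<lbrakk>1 \<le> m; 1 \<le> n; i \<in> {1..m}; a \<in> carrier (arity L m);
        b \<in> carrier (arity L n); x \<in> F m a; y \<in> F n b\<rbrakk>
      \<Longrightarrow> pcomp P m n i x y \<in> F (m + n - 1) (pcomp L m n i a b)"
    and FiltD_unit: "\<lbrakk>least (arity L 1) z (carrier (arity L 1)); op_unit P = Some e\<rbrakk>
      \<Longrightarrow> {c \<odot>\<^bsub>arity P 1\<^esub> e |c. c \<in> carrier K} \<subseteq> F 1 z"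
proof -
  note F = assms[unfolded Filt_def mem_Collect_eq]
  show "F \<in> (\<Pi>\<^sub>E n \<in> {1..}. \<Pi>\<^sub>E p \<in> carrier (arity L n). {V. submodule V K (arity P n)})"
    using F by (rule conjunct1)
  show "F n p \<subseteq> F n q"
    if "1 \<le> n" "p \<in> carrier (arity L n)" "q \<in> carrier (arity L n)" "p \<sqsubseteq>\<^bsub>arity L n\<^esub> q"
    using F[THEN conjunct2, THEN conjunct1] that by blast
  show "act P n \<sigma> ` F n p = F n (act L n \<sigma> p)"
    if "symm" "1 \<le> n" "p \<in> carrier (arity L n)" "\<sigma> permutes {1..n}"
    using F[THEN conjunct2, THEN conjunct2, THEN conjunct1] that by simp
  show "pcomp P m n i x y \<in> F (m + n - 1) (pcomp L m n i a b)"
    if "1 \<le> m" "1 \<le> n" "i \<in> {1..m}" "a \<in> carrier (arity L m)" "b \<in> carrier (arity L n)"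
      "x \<in> F m a" "y \<in> F n b"
    using F[THEN conjunct2, THEN conjunct2, THEN conjunct2, THEN conjunct1] that by simp
  show "{c \<odot>\<^bsub>arity P 1\<^esub> e |c. c \<in> carrier K} \<subseteq> F 1 z"
    if "least (arity L 1) z (carrier (arity L 1))" "op_unit P = Some e"
    using F[THEN conjunct2, THEN conjunct2, THEN conjunct2, THEN conjunct2] that by simp
qed

lemma Filt_submodule:
  assumes "F \<in> Filt symm K L P" "1 \<le> n" "p \<in> carrier (arity L n)"
  shows "submodule (F n p) K (arity P n)"
  using FiltD_PiE[OF assms(1)] assms(2,3) by (auto simp: PiE_iff)

text \<open>The laws of a morphism hold only on carriers; this makes them applicable to members of
  filtration pieces.\<close>

lemma Filt_carrier:
  assumes "F \<in> Filt symm K L P" "1 \<le> n" "p \<in> carrier (arity L n)" "x \<in> F n p"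
  shows "x \<in> carrier (arity P n)"
  using Filt_submodule[OF assms(1-3)] assms(4)
  by (auto simp: submodule_def subgroup_def)

lemma push_filt_in_Filt:
  assumes "lattice_operad symm L" and "linear_operad_morphism symm K P Q \<phi>"
    and F: "F \<in> Filt symm K L P"
  shows "push_filt symm K L P \<phi> F \<in> Filt symm K L Q"
proof -
  interpret L: lattice_operad symm L by fact
  interpret \<phi>: linear_operad_morphism symm K P Q \<phi> by fact
  let ?G = "push_filt symm K L P \<phi> F"
  note G = push_filt_apply[OF F]
  note F_mono = FiltD_mono[OF F] and F_act = FiltD_act[OF F]
    and F_pcomp = FiltD_pcomp[OF F] and F_unit = FiltD_unit[OF F]
  note FC = Filt_carrier[OF F]
  show ?thesis
    unfolding Filt_def mem_Collect_eq
  proof (intro conjI allI impI ballI)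
    show "?G \<in> (\<Pi>\<^sub>E n \<in> {1..}. \<Pi>\<^sub>E p \<in> carrier (arity L n). {V. submodule V K (arity Q n)})"
    proof -
      have "submodule (\<phi> n ` F n p) K (arity Q n)" if "1 \<le> n" "p \<in> carrier (arity L n)" for n p
        using submodule_image[OF \<phi>.source.arity_module \<phi>.target.arity_module \<phi>.linear
            Filt_submodule[OF F that]] that by blast
      \<comment> \<open>The inner restrictions in \<open>push_filt\<close> give the value
        \<open>undefined\<close> off the index set, as membership in the dependent products
        requires.\<close>
      then show ?thesis
        using F by (auto simp: push_filt_def PiE_iff)
    qed
    show "?G n p \<subseteq> ?G n q"
      if "1 \<le> n" "p \<in> carrier (arity L n)" "q \<in> carrier (arity L n)" "p \<sqsubseteq>\<^bsub>arity L n\<^esub> q" for n p q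
    proof -
      have "F n p \<subseteq> F n q" using that by (intro F_mono)
      then show ?thesis using that by (auto simp: G)
    qed
    show "act Q n \<sigma> ` ?G n p = ?G n (act L n \<sigma> p)"
      if "symm" "1 \<le> n" "p \<in> carrier (arity L n)" "\<sigma> permutes {1..n}" for n p \<sigma>
    proof -
      have "act Q n \<sigma> ` ?G n p = \<phi> n ` act P n \<sigma> ` F n p"
        unfolding G[OF that(2,3)] image_image
        using FC[OF that(2,3)] \<phi>.commutes_act[OF that(1,2,4)] by (intro image_cong) simp_all
      also have "act P n \<sigma> ` F n p = F n (act L n \<sigma> p)"
        using that by (intro F_act)
      finally show ?thesis
        \<comment> \<open>The pushed family is an image only at indices in the carrier, so the
          translated index must be shown to stay in \<open>L\<close>.\<close>
        unfolding G[OF that(2) L.act_closed[OF that(1,2,4,3)]] .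
    qed
    show "pcomp Q m n i x y \<in> ?G (m + n - 1) (pcomp L m n i a b)"
      if 1: "1 \<le> m" "1 \<le> n" "i \<in> {1..m}" "a \<in> carrier (arity L m)" "b \<in> carrier (arity L n)"
        and xy: "x \<in> ?G m a" "y \<in> ?G n b" for m n i a b x y
    proof -
      \<comment> \<open>Preimages chosen inside the filtration pieces, so that the composition
        condition for \<open>F\<close> applies to them.\<close>
      obtain u v where uv: "u \<in> F m a" "x = \<phi> m u" "v \<in> F n b" "y = \<phi> n v"
        using xy 1 by (auto simp: G)
      have "pcomp Q m n i x y = \<phi> (m + n - 1) (pcomp P m n i u v)"
        using 1 uv FC[of m a u] FC[of n b v] \<phi>.commutes_pcomp[of i m n u v] by simp
      moreover have "pcomp P m n i u v \<in> F (m + n - 1) (pcomp L m n i a b)"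
        using 1 uv(1,3) by (rule F_pcomp)
      \<comment> \<open>Subtraction on naturals is truncated; positivity of both arities puts the
        composite arity in the index range, so that \<open>G\<close> applies.\<close>
      moreover have "1 \<le> m + n - 1"
        using 1(1,2) by linarith
      ultimately show ?thesis
        using 1 L.pcomp_closed[of i m n a b] by (simp add: G)
    qed
    show "{c \<odot>\<^bsub>arity Q 1\<^esub> e |c. c \<in> carrier K} \<subseteq> ?G 1 z"
      if z: "least (arity L 1) z (carrier (arity L 1))" and e: "op_unit Q = Some e" for z e
    proof -
      \<comment> \<open>The equation of options in \<open>commutes_unit\<close> excludes
        \<open>None\<close> for \<open>P\<close> once \<open>Q\<close> has a unit, so the unit
        condition for \<open>F\<close> is available.\<close>
      obtain d where d: "op_unit P = Some d" "e = \<phi> 1 d"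
        using e \<phi>.commutes_unit by auto
      have sub: "{c \<odot>\<^bsub>arity P 1\<^esub> d |c. c \<in> carrier K} \<subseteq> F 1 z"
        using z d(1) by (rule F_unit)
      have "z \<in> carrier (arity L 1)"
        using z by (simp add: least_def)
      moreover have "c \<odot>\<^bsub>arity Q 1\<^esub> e = \<phi> 1 (c \<odot>\<^bsub>arity P 1\<^esub> d)" if "c \<in> carrier K" for c
        using that d \<phi>.linear[of 1] \<phi>.source.unit_closed[OF d(1)] by (auto simp: linear_maps_def)
      ultimately show ?thesis
        using sub by (auto simp: G)
    qed
  qed
qed

text \<open>On a filtration, both sides reduce piecewise to the image under a composite map. The
  restricted composition \<open>compose\<close> is used so that equality of functions means equality
  on \<open>Filt symm K L P\<close>.\<close>

lemma push_filt_morphism_comp: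
  assumes "lattice_operad symm L" and "linear_operad_morphism symm K P Q \<phi>"
  shows "push_filt symm K L P (morphism_comp \<psi> \<phi>)
    = compose (Filt symm K L P) (push_filt symm K L Q \<psi>) (push_filt symm K L P \<phi>)"
proof
  fix F
  show "push_filt symm K L P (morphism_comp \<psi> \<phi>) F
    = compose (Filt symm K L P) (push_filt symm K L Q \<psi>) (push_filt symm K L P \<phi>) F"
  proof (cases "F \<in> Filt symm K L P")
    case True
    then show ?thesis
      \<comment> \<open>Without this membership the outer restriction in
        \<open>push_filt symm K L Q \<psi>\<close> could not be evaluated.\<close>
      using push_filt_in_Filt[OF assms True]
      by (auto simp: push_filt_def compose_def morphism_comp_def image_comp
          intro!: restrict_ext)
  next
    case False
    \<comment> \<open>Outside the domain both sides are \<open>undefined\<close>.\<close>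
    then show ?thesis
      by (simp add: push_filt_def compose_def)
  qed
qed

theorem theorem6p2:
  fixes symm :: bool
    and K :: "('k, 'r) ring_scheme"
    and L :: "('l gorder, 'l) operad_struct"
    and P :: "(('k, 'p) module, 'p) operad_struct"
    and Q :: "(('k, 'q) module, 'q) operad_struct"
    and \<phi> :: "nat \<Rightarrow> 'p \<Rightarrow> 'q"
  assumes "lattice_operad symm L"
    and "linear_operad_morphism symm K P Q \<phi>"
  shows "push_filt symm K L P \<phi> \<in> Filt symm K L P \<rightarrow> Filt symm K L Q \<and>
    (\<forall>(R :: (('k, 's) module, 's) operad_struct) (\<psi> :: nat \<Rightarrow> 'q \<Rightarrow> 's).
      linear_operad_morphism symm K Q R \<psi> \<longrightarrow>
        push_filt symm K L P (morphism_comp \<psi> \<phi>)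
          = compose (Filt symm K L P) (push_filt symm K L Q \<psi>) (push_filt symm K L P \<phi>))"
  using push_filt_in_Filt[OF assms] push_filt_morphism_comp[OF assms] by blast

end
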